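(* Let $k$ and $\ell$ be integers with $k\geq\ell\geq 0$. Let $t=k-\ell$. Then every oriented $k$-tree $G$ has an oriented $\ell$-tree-partition $H$ in which each bag induces a weakly connected oriented $t$-tree in $G$, and moreover, for every node $x$ of $H$, the set of vertices $Q(x)=\bigcup_{v\in H_x}\bigl(N^-(v)\setminus H_x\bigr)$ is a $k'$-clique of $G$ for some $k'\leq k$.
   Context: All graphs are finite and simple (the graph with empty vertex set is allowed). An oriented graph $G$ is obtained from an undirected simple graph, denoted $\widehat{G}$ and called the underlying undirected graph of $G$, by giving each edge one of its two directions; $V(G)$ is its vertex set and $A(G)$ its arc set, where an arc $uv$ is oriented from $u$ to $v$. For a vertex $v$ of $G$, $N^-(v)=\{u\in V(G):uv\in A(G)\}$ is its in-neighbourhood. For $k\ge 0$, a $k$-clique of a graph is a set of $k$ pairwise adjacent vertices; a clique of an oriented graph means a clique of its underlying undirected graph. An oriented $k$-tree is an oriented graph $G$ that is acyclic (no directed cycles) and such that for every vertex $v$ of $G$, $N^-(v)$ is a $k'$-clique for some $k'\leq k$. For undirected graphs $G'$ and $H'$, with the elements of $V(H')$ called nodes, an $H'$-partition of $G'$ is a pair $(H',\{H'_x\subseteq V(G'):x\in V(H')\})$, where the sets $H'_x$ (called bags) are subsets of $V(G')$ indexed by the nodes of $H'$, such that: (i) for every vertex $v$ of $G'$ there is a node $x$ with $v\in H'_x$; (ii) for all distinct nodes $x,y$, $H'_x\cap H'_y=\emptyset$; (iii) for every edge $vw$ of $G'$, either there is a node $x$ with $v\in H'_x$ and $w\in H'_x$,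 or there is an edge $xy$ of $H'$ with $v\in H'_x$ and $w\in H'_y$. For oriented graphs $G$ and $H$, an oriented $H$-partition of $G$ is an $\widehat{H}$-partition of $\widehat{G}$, with bags $H_x$ ($x\in V(H)$), such that for every arc $xy$ of $H$ and every edge $vw$ of $\widehat{G}$ with $v\in H_x$ and $w\in H_y$, the edge $vw$ is oriented from $v$ to $w$ in $G$. An oriented $\ell$-tree-partition of $G$ is an oriented $H$-partition of $G$ for some oriented $\ell$-tree $H$; it is referred to simply as $H$. A bag $H_x$ induces a weakly connected oriented $t$-tree in $G$ if the induced oriented subgraph $G[H_x]$ (with orientation inherited from $G$) is an oriented $t$-tree whose underlying undirected graph is connected. *)

theory Defs
  imports "Graph_Theory.Digraph_Component"
begin

locale oriented_graph = digraph G for G :: "('a, 'b) pre_digraph" +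
  assumes one_direction: "u \<rightarrow>\<^bsub>G\<^esub> v \<Longrightarrow> \<not> v \<rightarrow>\<^bsub>G\<^esub> u"

(* Finite simple undirected graphs are symmetric loopfree digraphs (locale pair_graph of
   Graph_Theory). The underlying undirected graph of G is mk_symmetric G. *)
lemma (in oriented_graph) pair_graph_mk_symmetric: "pair_graph (mk_symmetric G)"
proof -
  interpret S: pair_digraph "mk_symmetric G" by (rule digraph_mk_symmetric)
  show ?thesis
    by unfold_locales (rule symmetric_mk_symmetric)
qed

definition in_nbhd :: "('a, 'b) pre_digraph \<Rightarrow> 'a \<Rightarrow> 'a set" where
  "in_nbhd G v = {u \<in> verts G. u \<rightarrow>\<^bsub>G\<^esub> v}"

definition is_clique :: "nat \<Rightarrow> 'a pair_pre_digraph \<Rightarrow> 'a set \<Rightarrow> bool" where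
  "is_clique k G S \<longleftrightarrow> S \<subseteq> pverts G \<and> finite S \<and> card S = k \<and>
     (\<forall>u\<in>S. \<forall>v\<in>S. u \<noteq> v \<longrightarrow> (u, v) \<in> parcs G)"

definition oriented_ktree :: "nat \<Rightarrow> ('a, 'b) pre_digraph \<Rightarrow> bool" where
  "oriented_ktree k G \<longleftrightarrow> oriented_graph G \<and> (\<nexists>p. pre_digraph.cycle G p) \<and>
     (\<forall>v\<in>verts G. \<exists>k'\<le>k. is_clique k' (mk_symmetric G) (in_nbhd G v))"

definition graph_partition ::
  "'a pair_pre_digraph \<Rightarrow> 'n pair_pre_digraph \<Rightarrow> ('n \<Rightarrow> 'a set) \<Rightarrow> bool" where
  "graph_partition G H B \<longleftrightarrow>
     (\<forall>x\<in>pverts H. B x \<subseteq> pverts G) \<and>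
     (\<forall>v\<in>pverts G. \<exists>x\<in>pverts H. v \<in> B x) \<and>
     (\<forall>x\<in>pverts H. \<forall>y\<in>pverts H. x \<noteq> y \<longrightarrow> B x \<inter> B y = {}) \<and>
     (\<forall>(v, w)\<in>parcs G. (\<exists>x\<in>pverts H. v \<in> B x \<and> w \<in> B x) \<or>
                        (\<exists>(x, y)\<in>parcs H. v \<in> B x \<and> w \<in> B y))"

definition oriented_partition ::
  "('a, 'b) pre_digraph \<Rightarrow> ('n, 'm) pre_digraph \<Rightarrow> ('n \<Rightarrow> 'a set) \<Rightarrow> bool" where
  "oriented_partition G H B \<longleftrightarrow>
     graph_partition (mk_symmetric G) (mk_symmetric H) B \<and>
     (\<forall>x y. x \<rightarrow>\<^bsub>H\<^esub> y \<longrightarrow>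
        (\<forall>(v, w)\<in>parcs (mk_symmetric G). v \<in> B x \<and> w \<in> B y \<longrightarrow> v \<rightarrow>\<^bsub>G\<^esub> w))"

definition oriented_tree_partition ::
  "nat \<Rightarrow> ('a, 'b) pre_digraph \<Rightarrow> ('n, 'm) pre_digraph \<Rightarrow> ('n \<Rightarrow> 'a set) \<Rightarrow> bool" where
  "oriented_tree_partition l G H B \<longleftrightarrow> oriented_ktree l H \<and> oriented_partition G H B"

(* connected is the library's weak connectedness; it excludes the null graph, so such a set S
   is nonempty. *)
definition induces_connected_oriented_ktree ::
  "nat \<Rightarrow> ('a, 'b) pre_digraph \<Rightarrow> 'a set \<Rightarrow> bool" where
  "induces_connected_oriented_ktree t G S \<longleftrightarrow>
     oriented_ktree t (G \<restriction> S) \<and> connected (G \<restriction> S)"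

end

theory Submission
  imports Defs
begin

text \<open>
  An oriented $k$-tree is built from the empty graph by repeatedly adding a sink \<open>v\<close> whose
  in-neighbourhood \<open>C\<close> is a clique of at most $k$ old vertices (\<open>ktree_on_induct\<close>,
  \<open>ktree_on_add_sink\<close>). The partition is built along with the graph, as a function \<open>p\<close> that sends
  every vertex to its node; the tree of the partition is then forced to be the quotient of the arcs
  along \<open>p\<close>, and nodes are named by vertices.

  Let a new sink \<open>v\<close> arrive with clique \<open>C\<close>. The nodes met by \<open>C\<close> form a clique \<open>p ` C\<close> of the
  quotient. If there are at most $l$ of them, \<open>v\<close> becomes a new sink node with the bag \<open>{v}\<close>, and
  the quotient remains an oriented $l$-tree. Otherwise there are at least $l + 1$, and an acyclic
  tournament has a sink \<open>y\<close>; the vertex \<open>v\<close> joins the bag \<open>S\<close> of \<open>y\<close>. Three things make this work: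

  \<^item> all other nodes of \<open>p ` C\<close> already have an arc to \<open>y\<close>, so the quotient does not change;

  \<^item> \<open>C\<close> has at least $l$ vertices outside \<open>S\<close>, one for each of these other nodes, so \<open>C \<inter> S\<close> is a
    nonempty clique of at most $k - l$ vertices, and adding \<open>v\<close> keeps \<open>S\<close> a connected oriented
    $(k - l)$-tree;

  \<^item> every vertex of \<open>C\<close> outside \<open>S\<close> is adjacent to a vertex \<open>c\<close> of \<open>C \<inter> S\<close>, and the arc enters
    \<open>S\<close> because \<open>y\<close> is the sink. Hence these vertices already belong to the set of outside
    in-neighbours of \<open>S\<close>, which therefore does not change either.

  The induction (\<open>ktree_on_partition\<close>) speaks of relations on a finite set of vertices, because
  adding a sink is then just a union and an induced subgraph a restriction.
\<close>

section \<open>Oriented trees as relations\<close>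

text \<open>
  Oriented $k$-trees given by their vertices and their arc relation; a clique is a set on which this
  relation is total.
\<close>
definition ktree_on :: "nat \<Rightarrow> 'a set \<Rightarrow> 'a rel \<Rightarrow> bool" where
  "ktree_on k V R \<longleftrightarrow> finite V \<and> R \<subseteq> V \<times> V \<and> acyclic R \<and>
     (\<forall>v\<in>V. total_on (R\<inverse> `` {v}) R \<and> card (R\<inverse> `` {v}) \<le> k)"

lemma ktree_on_empty: "ktree_on k {} {}"
  by (simp add: ktree_on_def acyclic_def)

text \<open>
  A path of the enlarged relation can use a new arc only as its last step, since nothing leaves
  \<open>v\<close>; so every path that does not end in \<open>v\<close> is old.
\<close>
lemma acyclic_add_sink:
  assumes "acyclic R" "v \<notin> Domain R" "v \<notin> C"
  shows "acyclic (R \<union> C \<times> {v})"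
proof (rule acyclicI, intro allI notI)
  fix x assume "(x, x) \<in> (R \<union> C \<times> {v})\<^sup>+"
  moreover have "x \<noteq> v \<and> (y = v \<or> (x, y) \<in> R\<^sup>+)" if "(x, y) \<in> (R \<union> C \<times> {v})\<^sup>+" for y
    using that
  proof induction
    case (base y)
    then show ?case using assms by auto
  next
    case (step y z)
    then show ?case using assms by (auto intro: trancl_into_trancl)
  qed
  ultimately show False using assms(1) by (auto simp: acyclic_def)
qed

lemma ktree_on_add_sink:
  assumes "ktree_on k V R" "v \<notin> V" "C \<subseteq> V" "total_on C R" "card C \<le> k"
  shows "ktree_on k (insert v V) (R \<union> C \<times> {v})"
proof -
  let ?R = "R \<union> C \<times> {v}"
  have R: "R \<subseteq> V \<times> V" using assms(1) by (simp add: ktree_on_def)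
  have nb: "?R\<inverse> `` {w} = (if w = v then C else R\<inverse> `` {w})" for w
    using R assms(2) by auto
  have "acyclic ?R"
    using assms R by (intro acyclic_add_sink) (auto simp: ktree_on_def)
  moreover have "total_on A ?R" if "total_on A R" for A
    using that by (auto simp: total_on_def)
  ultimately show ?thesis
    using assms R unfolding ktree_on_def nb by auto
qed

text \<open>
  A finite acyclic relation has a sink, and removing a sink changes no other in-neighbourhood.
\<close>
lemma ktree_on_induct [consumes 1, case_names empty add_sink]:
  assumes "ktree_on k V R"
    and empty: "P {} {}"
    and add_sink: "\<And>V R v C. \<lbrakk>ktree_on k V R; P V R; v \<notin> V; C \<subseteq> V; total_on C R; card C \<le> k\<rbrakk>
      \<Longrightarrow> P (insert v V) (R \<union> C \<times> {v})"
  shows "P V R"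
  using assms(1)
proof (induction "card V" arbitrary: V R)
  case 0
  then show ?case using empty by (auto simp: ktree_on_def)
next
  case (Suc n)
  have fin: "finite V" and R: "R \<subseteq> V \<times> V" and ac: "acyclic R"
    using Suc.prems by (auto simp: ktree_on_def)
  have "finite R" using fin R by (meson finite_SigmaI finite_subset)
  then have "wf (R\<inverse>)" using ac by (rule finite_acyclic_wf_converse)
  moreover have "V \<noteq> {}" using Suc.hyps(2) by auto
  ultimately obtain v where v: "v \<in> V" and sink: "\<And>w. (v, w) \<in> R \<Longrightarrow> w \<notin> V"
    by (metis wf_eq_minimal ex_in_conv converse_iff)
  define C where "C = R\<inverse> `` {v}"
  define V' where "V' = V - {v}"
  define R' where "R' = Restr R V'"
  have sink: "(v, w) \<notin> R" for w using sink R by auto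
  have V: "V = insert v V'" using v by (auto simp: V'_def)
  have Req: "R = R' \<union> C \<times> {v}"
    using R sink by (auto simp: R'_def V'_def C_def)
  have nb: "R'\<inverse> `` {w} = R\<inverse> `` {w}" if "w \<in> V'" for w
    using R sink that by (auto simp: R'_def V'_def)
  have C: "C \<subseteq> V'" using R sink by (auto simp: C_def V'_def)
  have tot: "total_on A R'" if "total_on A R" "A \<subseteq> V'" for A
    using that by (auto simp: total_on_def R'_def)
  have "ktree_on k V' R'"
    unfolding ktree_on_def
  proof (intro conjI ballI)
    show "finite V'" using fin by (simp add: V'_def)
    show "R' \<subseteq> V' \<times> V'" by (auto simp: R'_def)
    show "acyclic R'" using ac by (rule acyclic_subset) (auto simp: R'_def)
    fix w assume w: "w \<in> V'"
    then have *: "total_on (R\<inverse> `` {w}) R" "card (R\<inverse> `` {w}) \<le> k"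
      using Suc.prems by (auto simp: ktree_on_def V'_def)
    show "card (R'\<inverse> `` {w}) \<le> k" using * nb[OF w] by simp
    show "total_on (R'\<inverse> `` {w}) R'"
      using * nb[OF w] by (intro tot) (auto simp: R'_def)
  qed
  moreover have "n = card V'" using Suc.hyps(2) v fin by (simp add: V'_def)
  moreover have "total_on C R'" "card C \<le> k"
    using Suc.prems v C by (auto simp: ktree_on_def C_def intro!: tot)
  moreover have "v \<notin> V'" by (simp add: V'_def)
  ultimately show ?case
    unfolding V Req using C Suc.hyps(1) by (intro add_sink) auto
qed

lemma acyclic_tournament_has_sink:
  assumes "finite C" "C \<noteq> {}" "total_on C F" "acyclic F"
  obtains y where "y \<in> C" "\<And>x. x \<in> C \<Longrightarrow> x \<noteq> y \<Longrightarrow> (x, y) \<in> F"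
proof -
  have "acyclic (Restr F C)" using assms(4) by (rule acyclic_subset) auto
  then have "wf ((Restr F C)\<inverse>)"
    using assms(1) by (intro finite_acyclic_wf_converse) auto
  then obtain y where "y \<in> C" "\<And>x. (y, x) \<in> Restr F C \<Longrightarrow> x \<notin> C"
    using assms(2) by (metis wf_eq_minimal ex_in_conv converse_iff)
  then have "(x, y) \<in> F" if "x \<in> C" "x \<noteq> y" for x
    using that assms(3) unfolding total_on_def by blast
  then show ?thesis using \<open>y \<in> C\<close> that by blast
qed

section \<open>Bags and their boundaries\<close>

definition connected_on :: "'a rel \<Rightarrow> 'a set \<Rightarrow> bool" where
  "connected_on R S \<longleftrightarrow> S \<noteq> {} \<and> S \<times> S \<subseteq> ((Restr R S)\<^sup>s)\<^sup>*"

text \<open>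
  The in-neighbours that a bag has outside itself: the set $Q(x)$ of the theorem.
\<close>
definition boundary :: "'a rel \<Rightarrow> 'a set \<Rightarrow> 'a set" where
  "boundary R S = R\<inverse> `` S - S"

definition good_bag :: "nat \<Rightarrow> nat \<Rightarrow> 'a rel \<Rightarrow> 'a set \<Rightarrow> bool" where
  "good_bag k t R S \<longleftrightarrow> ktree_on t S (Restr R S) \<and> connected_on R S \<and>
     total_on (boundary R S) R \<and> card (boundary R S) \<le> k"

definition quotient_arcs :: "('a \<Rightarrow> 'n) \<Rightarrow> 'a rel \<Rightarrow> 'n rel" where
  "quotient_arcs p R = {(p u, p v) | u v. (u, v) \<in> R \<and> p u \<noteq> p v}"

lemma quotient_arcsI: "(u, v) \<in> R \<Longrightarrow> p u \<noteq> p v \<Longrightarrow> (p u, p v) \<in> quotient_arcs p R"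
  by (auto simp: quotient_arcs_def)

lemma symcl_conv: "R\<^sup>s = R \<union> R\<inverse>"
  by (auto simp: symcl_def)

lemma connected_on_singleton: "connected_on R {v}"
  by (auto simp: connected_on_def)

lemma connected_on_insert:
  assumes "connected_on R S" "c \<in> S" "(c, v) \<in> R"
  shows "connected_on R (insert v S)"
proof -
  let ?E = "(Restr R (insert v S))\<^sup>s"
  have sub: "((Restr R S)\<^sup>s)\<^sup>* \<subseteq> ?E\<^sup>*"
    by (intro rtrancl_mono) (auto simp: symcl_conv)
  have cv: "(c, v) \<in> ?E\<^sup>*" "(v, c) \<in> ?E\<^sup>*"
    using assms by (auto simp: symcl_conv)
  have to_c: "(u, c) \<in> ?E\<^sup>*" "(c, u) \<in> ?E\<^sup>*" if "u \<in> insert v S" for u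
    using that cv assms(1,2) sub by (auto simp: connected_on_def)
  have "(a, b) \<in> ?E\<^sup>*" if "a \<in> insert v S" "b \<in> insert v S" for a b
    using to_c(1)[OF that(1)] to_c(2)[OF that(2)] by (rule rtrancl_trans)
  then show ?thesis unfolding connected_on_def by blast
qed

lemma connected_on_mono:
  assumes "connected_on R S" "R \<subseteq> R'"
  shows "connected_on R' S"
proof -
  have "((Restr R S)\<^sup>s)\<^sup>* \<subseteq> ((Restr R' S)\<^sup>s)\<^sup>*"
    using assms(2) by (intro rtrancl_mono) (auto simp: symcl_conv)
  then show ?thesis using assms(1) by (auto simp: connected_on_def)
qed

text \<open>
  Arcs into \<open>v\<close> are invisible to a bag avoiding \<open>v\<close>, as a bag sees only its inner arcs and the arcs
  that enter it.
\<close>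
lemma good_bag_new_sink_outside:
  assumes "good_bag k t R S" "v \<notin> S"
  shows "good_bag k t (R \<union> C \<times> {v}) S"
proof -
  have "Restr (R \<union> C \<times> {v}) S = Restr R S" "boundary (R \<union> C \<times> {v}) S = boundary R S"
    using assms(2) by (auto simp: boundary_def)
  then show ?thesis
    using assms(1) by (auto simp: good_bag_def connected_on_def total_on_def)
qed

lemma good_bag_new_singleton:
  assumes "total_on C R" "card C \<le> k" "v \<notin> Range R" "v \<notin> C"
  shows "good_bag k t (R \<union> C \<times> {v}) {v}"
proof -
  have "Restr (R \<union> C \<times> {v}) {v} = {}" "boundary (R \<union> C \<times> {v}) {v} = C"
    using assms(3,4) by (auto simp: boundary_def)
  moreover have "connected_on (R \<union> C \<times> {v}) {v}" by (rule connected_on_singleton)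
  ultimately show ?thesis
    using assms(1,2) by (auto simp: good_bag_def ktree_on_def acyclic_def total_on_def)
qed

text \<open>
  The vertex \<open>c\<close> serves twice: it connects \<open>v\<close> to the bag, and the last hypothesis puts \<open>C - S\<close>
  into the old boundary, so that the boundary does not grow.
\<close>
lemma good_bag_add_sink:
  assumes "good_bag k t R S" "v \<notin> S" "v \<notin> Field R" "v \<notin> C" "total_on C R"
    and "c \<in> C \<inter> S" "card (C \<inter> S) \<le> t"
    and "\<And>d. d \<in> C - S \<Longrightarrow> (d, c) \<in> R"
  shows "good_bag k t (R \<union> C \<times> {v}) (insert v S)"
proof -
  let ?R = "R \<union> C \<times> {v}"
  have "ktree_on t (insert v S) (Restr R S \<union> (C \<inter> S) \<times> {v})"
    using assms by (intro ktree_on_add_sink) (auto simp: good_bag_def total_on_def)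
  moreover have "Restr ?R (insert v S) = Restr R S \<union> (C \<inter> S) \<times> {v}"
    using assms(2-4) by (auto simp: Field_def)
  moreover have "connected_on ?R (insert v S)"
  proof (rule connected_on_insert)
    show "connected_on ?R S"
      using assms(1) by (auto simp: good_bag_def intro: connected_on_mono[of R S])
  qed (use assms(6) in auto)
  moreover have "boundary ?R (insert v S) = boundary R S"
    using assms(2-4,6,8) by (auto simp: boundary_def Field_def)
  ultimately show ?thesis using assms(1) by (auto simp: good_bag_def total_on_def)
qed

section \<open>The partition\<close>

lemma quotient_arcs_add_sink:
  assumes "v \<notin> V" "R \<subseteq> V \<times> V" "C \<subseteq> V"
  shows "quotient_arcs (p(v := y)) (R \<union> C \<times> {v}) = quotient_arcs p R \<union> (p ` C - {y}) \<times> {y}"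
proof -
  have "u \<noteq> v \<and> w \<noteq> v" if "(u, w) \<in> R" for u w using that assms by auto
  moreover have "c \<noteq> v" if "c \<in> C" for c using that assms by auto
  ultimately show ?thesis
    unfolding quotient_arcs_def by (fastforce simp: image_iff)
qed

text \<open>
  The nodes are the values of \<open>p\<close>. Requiring \<open>p ` V \<subseteq> V\<close> lets a new vertex \<open>v\<close> serve as a new
  node, for then it cannot be in use as a name already.
\<close>
lemma ktree_on_partition:
  assumes "ktree_on k V R" "l \<le> k"
  shows "\<exists>p. p ` V \<subseteq> V \<and> ktree_on l (p ` V) (quotient_arcs p R) \<and>
    (\<forall>x\<in>p ` V. good_bag k (k - l) R {v \<in> V. p v = x})"
  using assms(1)
proof (induction rule: ktree_on_induct)
  case empty
  show ?case by (simp add: ktree_on_empty quotient_arcs_def)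
next
  case (add_sink V R v C)
  then obtain p where pV: "p ` V \<subseteq> V" and H: "ktree_on l (p ` V) (quotient_arcs p R)"
    and bags: "\<And>x. x \<in> p ` V \<Longrightarrow> good_bag k (k - l) R {v \<in> V. p v = x}"
    by auto
  have R: "R \<subseteq> V \<times> V" and finV: "finite V" using add_sink.hyps by (auto simp: ktree_on_def)
  have vR: "v \<notin> Field R" and vC: "v \<notin> C" using R add_sink.hyps by (auto simp: Field_def)
  have finC: "finite C" using finV add_sink.hyps finite_subset by blast
  define R' where "R' = R \<union> C \<times> {v}"
  have ac: "acyclic (quotient_arcs p R)" using H by (simp add: ktree_on_def)
  have tot: "total_on (p ` C) (quotient_arcs p R)"
  proof (rule total_onI)
    fix x y assume "x \<in> p ` C" "y \<in> p ` C" and ne: "x \<noteq> y"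
    then obtain a b where ab: "a \<in> C" "b \<in> C" "x = p a" "y = p b" by auto
    then have "(a, b) \<in> R \<or> (b, a) \<in> R" using add_sink.hyps ne by (auto simp: total_on_def)
    then show "(x, y) \<in> quotient_arcs p R \<or> (y, x) \<in> quotient_arcs p R"
      using ab ne by (metis quotient_arcsI)
  qed
  have quot: "quotient_arcs (p(v := y)) R' = quotient_arcs p R \<union> (p ` C - {y}) \<times> {y}" for y
    unfolding R'_def using add_sink.hyps R by (intro quotient_arcs_add_sink)
  show ?case
  proof (cases "card (p ` C) \<le> l")
    case True
    let ?p = "p(v := v)"
    have new: "v \<notin> p ` V" using pV add_sink.hyps by auto
    have img: "?p ` insert v V = insert v (p ` V)"
      using add_sink.hyps(2) by auto
    have "p ` C - {v} = p ` C" using new add_sink.hyps by auto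
    then have "quotient_arcs ?p R' = quotient_arcs p R \<union> p ` C \<times> {v}"
      by (simp add: quot)
    moreover have "ktree_on l (insert v (p ` V)) (quotient_arcs p R \<union> p ` C \<times> {v})"
      using H new tot True add_sink.hyps by (intro ktree_on_add_sink) auto
    moreover have "good_bag k (k - l) R' {u \<in> insert v V. ?p u = x}" if "x \<in> insert v (p ` V)" for x
    proof (cases "x = v")
      case True
      then have "{u \<in> insert v V. ?p u = x} = {v}" using new by auto
      then show ?thesis
        unfolding R'_def using good_bag_new_singleton add_sink.hyps vR vC
        by (metis Field_def UnCI)
    next
      case False
      then have "{u \<in> insert v V. ?p u = x} = {u \<in> V. p u = x}"
        using add_sink.hyps by auto
      then show ?thesis
        unfolding R'_def using bags[of x] that False add_sink.hyps
        by (simp add: good_bag_new_sink_outside)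
    qed
    ultimately show ?thesis
      using pV unfolding R'_def[symmetric]
      by (intro exI[of _ ?p]) (simp only: img, blast)
  next
    case False
    then have "p ` C \<noteq> {}" by auto
    then obtain y where y: "y \<in> p ` C"
      and into_y: "\<And>x. x \<in> p ` C \<Longrightarrow> x \<noteq> y \<Longrightarrow> (x, y) \<in> quotient_arcs p R"
      using acyclic_tournament_has_sink[OF _ _ tot ac] finC by blast
    then obtain c where c: "c \<in> C" "p c = y" by auto
    let ?p = "p(v := y)"
    have yV: "y \<in> p ` V" using y add_sink.hyps by auto
    have img: "?p ` insert v V = p ` V"
      using add_sink.hyps(2) yV by auto
    \<comment> \<open>All arcs that the quotient could gain lead into the sink \<open>y\<close> and are present already.\<close>
    have "quotient_arcs ?p R' = quotient_arcs p R"
      unfolding quot using into_y by auto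
    moreover have "good_bag k (k - l) R' {u \<in> insert v V. ?p u = x}" if x: "x \<in> p ` V" for x
    proof (cases "x = y")
      case True
      let ?S = "{u \<in> V. p u = y}"
      \<comment> \<open>Each node of \<open>p ` C\<close> other than \<open>y\<close> takes a vertex of \<open>C\<close> outside the bag of \<open>y\<close>.\<close>
      have "card (p ` C) \<le> card (insert y (p ` (C - ?S)))"
        using finC add_sink.hyps by (intro card_mono) auto
      also have "\<dots> \<le> Suc (card (C - ?S))"
        using finC card_image_le[of "C - ?S" p] by (simp add: card_insert_if)
      finally have "l \<le> card (C - ?S)" using False by simp
      then have small: "card (C \<inter> ?S) \<le> k - l"
        using card_Diff_subset_Int[of C ?S] finC add_sink.hyps(5) card_mono[OF finC, of "C \<inter> ?S"]
        by simp
      have "(d, c) \<in> R" if d: "d \<in> C - ?S" for d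
      proof -
        have dy: "p d \<noteq> y" using d add_sink.hyps by auto
        then have "(p d, y) \<in> quotient_arcs p R" using into_y d by auto
        then have "(y, p d) \<notin> quotient_arcs p R"
          using ac by (meson acyclic_def r_into_trancl' trancl_trans)
        then have "(c, d) \<notin> R" using c dy by (auto simp: quotient_arcs_def)
        then show ?thesis using add_sink.hyps c d dy unfolding total_on_def by auto
      qed
      then have "good_bag k (k - l) R' (insert v ?S)"
        unfolding R'_def using bags[OF yV] add_sink.hyps vR vC small c
        by (intro good_bag_add_sink[where c = c]) auto
      moreover have "{u \<in> insert v V. ?p u = x} = insert v ?S" using True add_sink.hyps by auto
      ultimately show ?thesis by simp
    next
      case False
      then have "{u \<in> insert v V. ?p u = x} = {u \<in> V. p u = x}"
        using add_sink.hyps by auto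
      then show ?thesis
        unfolding R'_def using bags[OF x] add_sink.hyps
        by (simp add: good_bag_new_sink_outside)
    qed
    ultimately show ?thesis
      using pV H unfolding R'_def[symmetric]
      by (intro exI[of _ ?p]) (simp only: img, blast)
  qed
qed

section \<open>From relations to digraphs\<close>

lemma parcs_mk_symmetric_conv: "parcs (mk_symmetric G) = arcs_ends G \<union> (arcs_ends G)\<inverse>"
  by (auto simp: parcs_mk_symmetric arcs_ends_conv)

lemma (in wf_digraph) no_cycle_iff_acyclic: "(\<nexists>p. cycle p) \<longleftrightarrow> acyclic (arcs_ends G)"
proof -
  have "(\<exists>p. cycle p) \<longleftrightarrow> (\<exists>p. closed_w p)"
    using closed_w_imp_cycle cycle_altdef by auto
  also have "\<dots> \<longleftrightarrow> (\<exists>u. u \<rightarrow>\<^sup>+ u)"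
    by (auto simp: closed_w_def reachable1_awalk)
  finally show ?thesis by (auto simp: acyclic_def)
qed

lemma is_clique_iff_total_on:
  "is_clique n (mk_symmetric G) S \<longleftrightarrow>
     S \<subseteq> verts G \<and> finite S \<and> card S = n \<and> total_on S (arcs_ends G)"
  by (auto simp: is_clique_def total_on_def parcs_mk_symmetric_conv)

lemma (in wf_digraph) in_nbhd_conv: "in_nbhd G v = (arcs_ends G)\<inverse> `` {v}"
  by (auto simp: in_nbhd_def dest: adj_in_verts)

text \<open>
  Two antiparallel arcs form a cycle, so acyclicity on the right yields the orientation that
  \<open>oriented_graph\<close> asks for.
\<close>
lemma (in digraph) oriented_ktree_iff_ktree_on:
  "oriented_ktree k G \<longleftrightarrow> ktree_on k (verts G) (arcs_ends G)"
proof -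
  have sub: "arcs_ends G \<subseteq> verts G \<times> verts G" by (auto dest: adj_in_verts)
  then have "(arcs_ends G)\<inverse> `` {v} \<subseteq> verts G" for v by auto
  moreover from this have "finite ((arcs_ends G)\<inverse> `` {v})" for v
    by (rule finite_subset) simp
  moreover have "oriented_graph G" if "acyclic (arcs_ends G)"
    using that by unfold_locales (meson acyclic_def r_into_trancl' trancl_trans)
  ultimately show ?thesis
    using sub unfolding oriented_ktree_def ktree_on_def no_cycle_iff_acyclic
    by (auto simp: in_nbhd_conv is_clique_iff_total_on)
qed

lemma arcs_ends_induce_subgraph: "arcs_ends (G \<restriction> S) = Restr (arcs_ends G) S"
  by (auto simp: arcs_ends_conv)

lemma (in digraph) digraph_induce_subgraph:
  assumes "finite S"
  shows "digraph (G \<restriction> S)"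
  using assms no_loops no_multi_arcs by unfold_locales auto

text \<open>
  The library restricts walks to the vertex set; arcs of the induced subgraph never leave it, so the
  plain transitive closure agrees.
\<close>
lemma connected_iff_connected_on:
  "connected (G \<restriction> S) \<longleftrightarrow> connected_on (arcs_ends G) S"
proof -
  let ?E = "(Restr (arcs_ends G) S)\<^sup>s"
  have "(u, v) \<in> rtrancl_on S ?E \<longleftrightarrow> (u, v) \<in> ?E\<^sup>*" if "u \<in> S" "v \<in> S" for u v
  proof
    show "(u, v) \<in> rtrancl_on S ?E" if "(u, v) \<in> ?E\<^sup>*"
      using that by (rule rtrancl_consistent_rtrancl_on) (auto simp: symcl_conv \<open>u \<in> S\<close> \<open>v \<in> S\<close>)
  qed (rule rtrancl_on_rtranclI)
  then show ?thesis
    by (auto simp: connected_conv connected_on_def arcs_ends_induce_subgraph)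
qed

lemma ktree_on_imp_digraph:
  assumes "ktree_on k W F"
  shows "digraph (with_proj \<lparr>pverts = W, parcs = F\<rparr>)"
proof -
  have "finite F"
    using assms unfolding ktree_on_def by (meson finite_SigmaI finite_subset)
  moreover have "(u, u) \<notin> F" for u
    using assms by (auto simp: ktree_on_def acyclic_def)
  ultimately show ?thesis
    using assms by unfold_locales (auto simp: ktree_on_def arc_to_ends_def)
qed

theorem theorem2:
  fixes k l t :: nat and G :: "('a, 'b) pre_digraph"
  assumes "k \<ge> l" and "t = k - l"
    and "oriented_ktree k G"
  shows "\<exists>(H :: ('a, 'a \<times> 'a) pre_digraph) (B :: 'a \<Rightarrow> 'a set).
           oriented_tree_partition l G H B \<and>
           (\<forall>x\<in>verts H. induces_connected_oriented_ktree t G (B x)) \<and>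
           (\<forall>x\<in>verts H. \<exists>k'\<le>k. is_clique k' (mk_symmetric G)
              (\<Union>v\<in>B x. in_nbhd G v - B x))"
proof -
  interpret oriented_graph G using assms(3) by (simp add: oriented_ktree_def)
  let ?V = "verts G" and ?R = "arcs_ends G"
  have "ktree_on k ?V ?R" using assms(3) by (simp add: oriented_ktree_iff_ktree_on)
  then obtain p where pV: "p ` ?V \<subseteq> ?V"
    and tree: "ktree_on l (p ` ?V) (quotient_arcs p ?R)"
    and bags: "\<And>x. x \<in> p ` ?V \<Longrightarrow> good_bag k t ?R {v \<in> ?V. p v = x}"
    using ktree_on_partition[OF _ assms(1), of ?V ?R] unfolding assms(2) by auto
  define H where "H = with_proj \<lparr>pverts = p ` ?V, parcs = quotient_arcs p ?R\<rparr>"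
  define B where "B x = {v \<in> ?V. p v = x}" for x
  have vH: "verts H = p ` ?V" and aH: "arcs_ends H = quotient_arcs p ?R"
    by (simp_all add: H_def)
  interpret H: digraph H unfolding H_def using tree by (rule ktree_on_imp_digraph)
  have arc: "u \<in> ?V" "v \<in> ?V" "p u \<noteq> p v \<Longrightarrow> (p u, p v) \<in> quotient_arcs p ?R"
    if "(u, v) \<in> ?R" for u v
    using that by (auto simp: quotient_arcs_def dest: adj_in_verts)
  \<comment> \<open>The orientation condition rests on this: an edge of \<open>G\<close> directed against an arc of \<open>H\<close> would
    project to the reverse arc.\<close>
  have asym: "(y, x) \<notin> quotient_arcs p ?R" if "(x, y) \<in> quotient_arcs p ?R" for x y
    using that tree unfolding ktree_on_def acyclic_def by (meson r_into_trancl' trancl_trans)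
  have "graph_partition (mk_symmetric G) (mk_symmetric H) B"
    unfolding graph_partition_def
  proof (intro conjI)
    show "\<forall>(v, w)\<in>parcs (mk_symmetric G).
        (\<exists>x\<in>pverts (mk_symmetric H). v \<in> B x \<and> w \<in> B x) \<or>
        (\<exists>(x, y)\<in>parcs (mk_symmetric H). v \<in> B x \<and> w \<in> B y)"
      unfolding parcs_mk_symmetric_conv aH pverts_mk_symmetric vH
    proof clarify
      fix v w
      assume e: "(v, w) \<in> ?R \<union> ?R\<inverse>"
        and no: "\<not> (\<exists>(x, y)\<in>quotient_arcs p ?R \<union> (quotient_arcs p ?R)\<inverse>. v \<in> B x \<and> w \<in> B y)"
      have V: "v \<in> ?V" "w \<in> ?V" using e arc by auto
      have "p v = p w"
      proof (rule ccontr)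
        assume "p v \<noteq> p w"
        then have "(p v, p w) \<in> quotient_arcs p ?R \<union> (quotient_arcs p ?R)\<inverse>"
          using e arc(3) by fastforce
        then show False using no V by (auto simp: B_def)
      qed
      then show "\<exists>x\<in>p ` ?V. v \<in> B x \<and> w \<in> B x" using V by (auto simp: B_def)
    qed
  qed (auto simp: vH B_def)
  moreover have "v \<rightarrow>\<^bsub>G\<^esub> w"
    if "x \<rightarrow>\<^bsub>H\<^esub> y" "(v, w) \<in> parcs (mk_symmetric G)" "v \<in> B x" "w \<in> B y" for x y v w
  proof (rule ccontr)
    assume "\<not> v \<rightarrow>\<^bsub>G\<^esub> w"
    then have wv: "w \<rightarrow>\<^bsub>G\<^esub> v" using that(2) by (auto simp: parcs_mk_symmetric_conv)
    have "p v = x" "p w = y" using that by (auto simp: B_def)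
    moreover have "x \<noteq> y" using that(1) H.adj_not_same by blast
    ultimately have "(y, x) \<in> quotient_arcs p ?R" using arc(3)[OF wv] by simp
    then show False using asym that(1) by (simp add: aH)
  qed
  moreover have "oriented_ktree l H"
    unfolding H.oriented_ktree_iff_ktree_on vH aH by (rule tree)
  ultimately have "oriented_tree_partition l G H B"
    by (auto simp: oriented_tree_partition_def oriented_partition_def)
  moreover have "induces_connected_oriented_ktree t G (B x)" if "x \<in> verts H" for x
  proof -
    interpret S: digraph "G \<restriction> B x" by (rule digraph_induce_subgraph) (simp add: B_def)
    have "good_bag k t ?R (B x)" using bags that by (simp add: vH B_def)
    then show ?thesis
      by (simp add: induces_connected_oriented_ktree_def S.oriented_ktree_iff_ktree_on
          arcs_ends_induce_subgraph connected_iff_connected_on good_bag_def)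
  qed
  moreover have "\<exists>k'\<le>k. is_clique k' (mk_symmetric G) (\<Union>v\<in>B x. in_nbhd G v - B x)"
    if "x \<in> verts H" for x
  proof -
    have "(\<Union>v\<in>B x. in_nbhd G v - B x) = boundary ?R (B x)"
      by (auto simp: in_nbhd_conv boundary_def)
    moreover have "boundary ?R (B x) \<subseteq> ?V" by (auto simp: boundary_def dest: adj_in_verts)
    moreover from this have "finite (boundary ?R (B x))" by (rule finite_subset) simp
    moreover have "good_bag k t ?R (B x)" using bags that by (simp add: vH B_def)
    ultimately show ?thesis by (simp add: is_clique_iff_total_on good_bag_def)
  qed
  ultimately show ?thesis by blast
qed

end
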